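(* Let $(T,d)$ be a metric space and $m$ a Borel probability measure on $T$ with $\operatorname{supp}(m)=T$. Let $a,b\ge 0$, $\varphi\in\mathcal{G}_{a,b}$ and $R\ge 2$. Put $A=\frac{R^3}{(R-1)(R-2)}$ and $B=\frac{R^2}{R-1}$. Then there exists a probability measure $\nu$ on $T\times T$ such that for all continuous functions $f:T\to\mathbb{R}$, $$\sup_{s,t\in T}|f(s)-f(t)|\le 2aA\,\mathcal{S}+2bB\,\bar{\mathcal{S}}\int_{T\times T}\varphi\left(\frac{|f(u)-f(v)|}{d(u,v)}\right)\nu(du,dv).$$
   Context: $B(x,\varepsilon)=\{y\in T:d(x,y)\le\varepsilon\}$ is the closed ball and $D(T)=\sup\{d(s,t):s,t\in T\}$ the diameter of $T$ (possibly $+\infty$). For $a,b\ge0$, $\mathcal{G}_{a,b}$ is the class of all functions $\varphi:\mathbb{R}_+\to\mathbb{R}$ that are (strictly) increasing and continuous, satisfy $\varphi(0)=0$, and satisfy $x\le a+b\frac{\varphi(xy)}{\varphi(y)}$ for all $x\ge 0$, $y\ge\varphi^{-1}(1)$; it is understood that the inverse $\varphi^{-1}$ is defined on $[0,\infty)$. Define $\sigma(x)=\int_0^{D(T)}\varphi^{-1}\left(\frac{1}{m(B(x,\varepsilon))}\right)d\varepsilon\in[0,\infty]$, $\bar{\mathcal{S}}=\int_T\sigma(u)\,m(du)\in[0,\infty]$ and $\mathcal{S}=\sup_{x\in T}\sigma(x)\in[0,\infty]$. Conventions: $0/0=0$ (in particular the integrand equals $\varphi(0)=0$ on the diagonal $u=v$);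 for $R=2$, $A=+\infty$; and $0\cdot\infty=0$. *)

theory Defs
  imports "HOL-Probability.Probability"
begin

text \<open>The metric space \<open>T\<close> is the universe of a type of class \<open>metric_space\<close>.\<close>

definition measure_support :: "'a::topological_space measure \<Rightarrow> 'a set" where
  "measure_support m = {x. \<forall>U. open U \<and> x \<in> U \<longrightarrow> emeasure m U > 0}"

definition inv_nonneg :: "(real \<Rightarrow> real) \<Rightarrow> real \<Rightarrow> real" where
  "inv_nonneg \<phi> = inv_into {0..} \<phi>"

text \<open>
  Only the values of \<open>\<phi>\<close> on \<open>{0..}\<close> matter. The condition \<open>\<phi> ` {0..} = {0..}\<close> expresses that
  the inverse of \<open>\<phi>\<close> is defined on all of \<open>{0..}\<close>.
\<close>

definition G_class :: "real \<Rightarrow> real \<Rightarrow> (real \<Rightarrow> real) set" where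
  "G_class a b = {\<phi>. strict_mono_on {0..} \<phi> \<and> continuous_on {0..} \<phi> \<and> \<phi> 0 = 0 \<and>
     \<phi> ` {0..} = {0..} \<and>
     (\<forall>x\<ge>0. \<forall>y\<ge>inv_nonneg \<phi> 1. x \<le> a + b * (\<phi> (x * y) / \<phi> y))}"

definition ediam :: "'a::metric_space set \<Rightarrow> ennreal" where
  "ediam X = (SUP s\<in>X. SUP t\<in>X. ennreal (dist s t))"

text \<open>
  The endpoint \<open>\<epsilon> = 0\<close> (a null set) is left out, since the ball of radius 0 may have measure 0.
\<close>

definition sigma_fun :: "(real \<Rightarrow> real) \<Rightarrow> 'a::metric_space measure \<Rightarrow> 'a \<Rightarrow> ennreal" where
  "sigma_fun \<phi> m x =
     (\<integral>\<^sup>+\<epsilon>\<in>{\<epsilon>. 0 < \<epsilon> \<and> ennreal \<epsilon> \<le> ediam (UNIV :: 'a set)}.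
        ennreal (inv_nonneg \<phi> (1 / measure m (cball x \<epsilon>))) \<partial>lborel)"

definition S_bar :: "(real \<Rightarrow> real) \<Rightarrow> 'a::metric_space measure \<Rightarrow> ennreal" where
  "S_bar \<phi> m = (\<integral>\<^sup>+u. sigma_fun \<phi> m u \<partial>m)"

definition S_sup :: "(real \<Rightarrow> real) \<Rightarrow> 'a::metric_space measure \<Rightarrow> ennreal" where
  "S_sup \<phi> m = (SUP x. sigma_fun \<phi> m x)"

definition A_const :: "real \<Rightarrow> ennreal" where
  "A_const R = (if R = 2 then \<infinity> else ennreal (R ^ 3 / ((R - 1) * (R - 2))))"

definition B_const :: "real \<Rightarrow> ennreal" where
  "B_const R = ennreal (R ^ 2 / (R - 1))"

end

theory Submission
  imports Defs
begin

text \<open>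
  Put \<open>y\<^sub>k = \<phi>\<^sup>-\<^sup>1(1) R\<^sup>k\<close>, let \<open>r\<^sub>k(x)\<close> be the least radius with
  \<open>m(B(x, r\<^sub>k(x))) \<ge> 1 / \<phi>(y\<^sub>k)\<close>, let \<open>S\<^sub>k f(x)\<close> be the mean of \<open>f\<close> over that ball and
  \<open>w\<^sub>k = y\<^sub>k\<^sub>+\<^sub>1 r\<^sub>k\<close>. Then \<open>S\<^sub>0 f = \<integral>f dm\<close> and \<open>S\<^sub>k f(t) \<rightarrow> f(t)\<close>. In
  \<open>S\<^sub>k\<^sub>+\<^sub>1 f - \<integral>f dm = S\<^sub>k\<^sub>+\<^sub>1 (f - S\<^sub>k f) + S\<^sub>k\<^sub>+\<^sub>1 (S\<^sub>k f - \<integral>f dm)\<close> the growth condition at \<open>y\<^sub>k\<^sub>+\<^sub>1\<close>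
  bounds \<open>\<bar>f(u) - f(v)\<bar>\<close>, \<open>d(u,v) \<le> r\<^sub>k(u)\<close>, by
  \<open>w\<^sub>k(u) (a + b m(B) \<phi>(\<bar>f(u) - f(v)\<bar> / d(u,v)))\<close>, where \<open>B\<close> is the ball over which \<open>S\<^sub>k\<^sub>+\<^sub>1\<close>
  averages; the factor \<open>m(B)\<close> cancels the normalisation of that mean.

  If \<open>a + K/(R - 1) \<le> K\<close>, then \<open>P\<^sub>k = K (\<Sum>\<^sub>j\<^sub><\<^sub>k w\<^sub>j + w\<^sub>k/(R - 1))\<close> satisfies
  \<open>a w\<^sub>k + P\<^sub>k \<le> K \<Sum>\<^sub>j\<^sub>\<le>\<^sub>k w\<^sub>j\<close>. On \<open>B\<close> the right-hand side exceeds its value at the centre \<open>x\<close> by at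
  most \<open>K w\<^sub>k\<^sub>+\<^sub>1(x)/(R - 1)\<close>, because the \<open>r\<^sub>j\<close> are 1-Lipschitz and the \<open>y\<^sub>j\<close> geometric. Hence
  \<open>P\<^sub>k\<close> dominates the terms with \<open>a\<close>. Slicing the integral \<open>\<sigma>\<close> at the levels \<open>y\<^sub>k\<close> gives
  \<open>\<Sum>\<^sub>k w\<^sub>k \<le> R\<^sup>2/(R - 1) \<sigma>\<close>, so for \<open>R > 2\<close> the choice \<open>K = a R/(R - 2)\<close> yields the constant \<open>a A\<close>.
  The terms with \<open>b\<close> add up to the integral against
  \<open>\<Sum>\<^sub>k w\<^sub>k(u) m(du) m(dv | B(u, r\<^sub>k(u)))\<close>, and \<open>\<nu>\<close> is this measure normalised. If the integral
  of \<open>\<sigma>\<close> is infinite, \<open>\<nu> = m \<otimes> m\<close> works.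
\<close>

section \<open>Measures of full support on metric spaces\<close>

lemma (in finite_measure) countable_disjoint_positive_sets:
  assumes disj: "disjoint_family_on A I"
    and A: "\<And>i. i \<in> I \<Longrightarrow> A i \<in> sets M" "\<And>i. i \<in> I \<Longrightarrow> 0 < measure M (A i)"
  shows "countable I"
proof -
  have "(\<Sum>i\<in>F. measure M (A i)) \<le> measure M (space M)" if "F \<subseteq> I" "finite F" for F
  proof -
    have "(\<Sum>i\<in>F. measure M (A i)) = measure M (\<Union>i\<in>F. A i)"
      using that A disjoint_family_on_mono[OF \<open>F \<subseteq> I\<close> disj]
      by (intro finite_measure_finite_Union[symmetric]) auto
    then show ?thesis by (simp add: bounded_measure)
  qed
  then have "bdd_above (sum (\<lambda>i. measure M (A i)) ` {F. F \<subseteq> I \<and> finite F})"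
    by (auto intro!: bdd_aboveI2)
  then have "(\<lambda>i. measure M (A i)) summable_on I"
    by (intro nonneg_bdd_above_summable_on) simp_all
  then have "countable {i \<in> I. measure M (A i) \<noteq> 0}"
    by (rule summable_countable_real)
  also have "{i \<in> I. measure M (A i) \<noteq> 0} = I"
    using A by force
  finally show ?thesis .
qed

lemma ex_maximal_separated_set:
  fixes e :: real
  assumes "0 < e"
  shows "\<exists>S :: 'a::metric_space set. pairwise (\<lambda>x y. e \<le> dist x y) S \<and> (\<forall>x. \<exists>s\<in>S. dist s x < e)"
proof -
  define \<A> where "\<A> = {S :: 'a set. pairwise (\<lambda>x y. e \<le> dist x y) S}"
  have "\<Union>\<C> \<in> \<A>" if "subset.chain \<A> \<C>" for \<C>
    using that unfolding \<A>_def subset_chain_def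
    by (auto intro!: pairwise_chain_Union simp: chain_subset_def)
  moreover have "\<A> \<noteq> {}"
    unfolding \<A>_def using pairwise_empty by blast
  ultimately obtain S where S: "S \<in> \<A>" "\<And>X. X \<in> \<A> \<Longrightarrow> S \<subseteq> X \<Longrightarrow> X = S"
    using subset_Zorn_nonempty[of \<A>] by blast
  have "\<exists>s\<in>S. dist s x < e" for x
  proof (rule ccontr)
    assume far: "\<not> ?thesis"
    then have "insert x S \<in> \<A>"
      using S(1) by (auto simp: \<A>_def pairwise_insert dist_commute not_less)
    then have "insert x S = S" by (rule S(2)) blast
    then have "x \<in> S" by blast
    then show False using far \<open>0 < e\<close> by force
  qed
  then show ?thesis using S(1) by (auto simp: \<A>_def)
qed

lemma topological_basis_dense_balls:
  fixes C :: "'a::metric_space set"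
  assumes "closure C = UNIV"
  shows "topological_basis ((\<lambda>(c, n). ball c (1 / Suc n)) ` (C \<times> UNIV))"
proof (rule topological_basisI)
  fix U :: "'a set" and x assume "open U" "x \<in> U"
  then obtain e where e: "0 < e" "ball x e \<subseteq> U" by (rule openE)
  obtain n :: nat where n: "1 / Suc n < e / 2"
    using nat_approx_posE[of "e / 2"] e by auto
  have "x \<in> closure C" using assms by simp
  then obtain c where c: "c \<in> C" "dist c x < 1 / Suc n"
    unfolding closure_approachable by (meson of_nat_0_less_iff zero_less_Suc zero_less_divide_1_iff)
  have "ball c (1 / Suc n) \<subseteq> ball x e"
  proof
    fix z assume "z \<in> ball c (1 / Suc n)"
    then show "z \<in> ball x e" using c n dist_triangle[of x z c] by (simp add: dist_commute)
  qed
  with c e show "\<exists>B\<in>(\<lambda>(c, n). ball c (1 / Suc n)) ` (C \<times> UNIV). x \<in> B \<and> B \<subseteq> U"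
    by (intro bexI[of _ "ball c (1 / Suc n)"]) auto
qed auto

lemma sets_borel_prod_countable_basis:
  fixes A :: "'a::topological_space set set" and B :: "'b::topological_space set set"
  assumes "countable A" "topological_basis A" "countable B" "topological_basis B"
  shows "sets (borel \<Otimes>\<^sub>M borel) = sets (borel :: ('a \<times> 'b) measure)"
proof
  have "fst \<in> borel_measurable (borel :: ('a \<times> 'b) measure)"
    "snd \<in> borel_measurable (borel :: ('a \<times> 'b) measure)"
    by (auto intro!: borel_measurable_continuous_onI continuous_intros)
  then have "fst -` S \<inter> snd -` T \<in> sets (borel :: ('a \<times> 'b) measure)"
    if "S \<in> sets borel" "T \<in> sets borel" for S T
    using that by (metis measurable_sets_borel sets.Int)
  also have "fst -` S \<inter> snd -` T = S \<times> T" for S :: "'a set" and T :: "'b set"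
    by auto
  finally show "sets (borel \<Otimes>\<^sub>M borel) \<subseteq> sets (borel :: ('a \<times> 'b) measure)"
    by (intro sets_pair_in_sets)
next
  let ?P = "(\<lambda>(S, T). S \<times> T) ` (A \<times> B)"
  have "sets (borel :: ('a \<times> 'b) measure) = sets (sigma UNIV ?P)"
    using assms by (subst borel_eq_countable_basis[of ?P]) (auto intro!: topological_basis_prod)
  also have "\<dots> = sigma_sets UNIV ?P"
    by (rule sets_measure_of) simp
  also have "\<dots> \<subseteq> sets (borel \<Otimes>\<^sub>M borel)"
  proof (rule sets.sigma_sets_subset')
    show "UNIV \<in> sets (borel \<Otimes>\<^sub>M borel :: ('a \<times> 'b) measure)"
      using sets.top[of "borel \<Otimes>\<^sub>M borel :: ('a \<times> 'b) measure"] by (simp add: space_pair_measure)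
    have "S \<times> T \<in> sets (borel \<Otimes>\<^sub>M borel)" if "S \<in> A" "T \<in> B" for S T
      using that topological_basis_open[OF assms(2)] topological_basis_open[OF assms(4)]
      by (intro pair_measureI) simp_all
    then show "?P \<subseteq> sets (borel \<Otimes>\<^sub>M borel)" by auto
  qed
  finally show "sets (borel :: ('a \<times> 'b) measure) \<subseteq> sets (borel \<Otimes>\<^sub>M borel)" .
qed

lemma measurable_continuous_sets_eq_borel:
  assumes "sets M = sets borel" "continuous_on UNIV g"
  shows "g \<in> borel_measurable M"
  using borel_measurable_continuous_onI[OF assms(2)]
  by (simp cong: measurable_cong_sets[OF assms(1) refl])

locale borel_prob_space = prob_space m for m :: "'a::metric_space measure" +
  assumes sets_eq_borel: "sets m = sets borel"
begin

lemma space_eq_UNIV: "space m = UNIV"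
  using sets_eq_imp_space_eq[OF sets_eq_borel] by simp

lemma sets_cball [measurable, simp]: "cball x r \<in> sets m"
  by (simp add: sets_eq_borel)

lemmas measurable_continuous = measurable_continuous_sets_eq_borel[OF sets_eq_borel]

lemma measurable_section:
  assumes "g \<in> borel_measurable (m \<Otimes>\<^sub>M m)"
  shows "(\<lambda>v. g (u, v)) \<in> borel_measurable m"
  using measurable_compose[OF measurable_Pair1' assms] by (simp add: space_eq_UNIV)

end

locale full_support_prob_space = borel_prob_space +
  assumes full_support: "measure_support m = UNIV"
begin

lemma emeasure_open_pos: "open U \<Longrightarrow> x \<in> U \<Longrightarrow> 0 < emeasure m U"
  using full_support unfolding measure_support_def by blast

lemma measure_ball_pos:
  assumes "0 < r"
  shows "0 < measure m (ball x r)"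
  using emeasure_open_pos[of "ball x r" x] assms by (simp add: emeasure_eq_measure)

lemma measure_cball_pos:
  assumes "0 < r"
  shows "0 < measure m (cball x r)"
  using measure_ball_pos[OF assms, of x] finite_measure_mono[of "ball x r" "cball x r"]
  by (simp add: ball_subset_cball)

lemma ex_countable_dense: "\<exists>C :: 'a set. countable C \<and> closure C = UNIV"
proof -
  have "\<exists>S :: 'a set. countable S \<and> (\<forall>x. \<exists>s\<in>S. dist s x < e)" if "0 < e" for e
  proof -
    obtain S :: "'a set"
      where sep: "pairwise (\<lambda>x y. e \<le> dist x y) S" and net: "\<forall>x. \<exists>s\<in>S. dist s x < e"
      using ex_maximal_separated_set[OF \<open>0 < e\<close>] by blast
    have "disjoint_family_on (\<lambda>x. ball x (e / 2)) S"
      using sep by (auto simp: disjoint_family_on_def pairwise_def disjoint_ballI)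
    then have "countable S"
      using \<open>0 < e\<close> measure_ball_pos sets_eq_borel
      by (intro countable_disjoint_positive_sets[of "\<lambda>x. ball x (e / 2)"]) auto
    with net show ?thesis by blast
  qed
  then have "\<forall>e. \<exists>S :: 'a set. 0 < e \<longrightarrow> countable S \<and> (\<forall>x. \<exists>s\<in>S. dist s x < e)"
    by blast
  then obtain N :: "real \<Rightarrow> 'a set"
    where N: "\<And>e. 0 < e \<Longrightarrow> countable (N e) \<and> (\<forall>x. \<exists>s\<in>N e. dist s x < e)"
    unfolding choice_iff by blast
  have "x \<in> closure (\<Union>n. N (1 / Suc n))" for x
    unfolding closure_approachable
  proof (intro allI impI)
    fix e :: real assume "0 < e"
    then obtain n :: nat where "1 / Suc n < e" by (rule nat_approx_posE)
    then show "\<exists>y\<in>\<Union>n. N (1 / Suc n). dist y x < e"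
      using N[of "1 / Suc n"] by (force intro: less_trans)
  qed
  moreover have "countable (\<Union>n. N (1 / Suc n))" using N by simp
  ultimately show ?thesis by blast
qed

lemma sets_pair_eq_borel: "sets (m \<Otimes>\<^sub>M m) = sets borel"
proof -
  obtain C :: "'a set" where "countable C" "closure C = UNIV"
    using ex_countable_dense by blast
  then have "sets (borel \<Otimes>\<^sub>M borel) = sets (borel :: ('a \<times> 'a) measure)"
    by (intro sets_borel_prod_countable_basis[OF _ topological_basis_dense_balls
          _ topological_basis_dense_balls]) auto
  then show ?thesis
    using sets_pair_measure_cong[OF sets_eq_borel sets_eq_borel] by simp
qed

lemma AE_pair_eq_imp_constant:
  fixes f :: "'a \<Rightarrow> 'b::t2_space"
  assumes f: "continuous_on UNIV f" and eq: "AE (u, v) in m \<Otimes>\<^sub>M m. f u = f v"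
  shows "f s = f t"
proof (rule ccontr)
  assume "f s \<noteq> f t"
  from hausdorff[OF this] obtain S T
    where ST: "open S" "open T" "f s \<in> S" "f t \<in> T" "S \<inter> T = {}" by blast
  define U where "U = f -` S"
  define V where "V = f -` T"
  have UV: "open U" "open V" "s \<in> U" "t \<in> V"
    using ST f by (auto simp: U_def V_def open_vimage)
  have "AE z in m \<Otimes>\<^sub>M m. z \<notin> U \<times> V"
    using eq ST(5) by (auto simp: U_def V_def elim!: eventually_mono)
  then have "emeasure (m \<Otimes>\<^sub>M m) (U \<times> V) = 0"
    using UV by (subst (asm) AE_iff_measurable[of "U \<times> V"])
      (auto simp: space_pair_measure space_eq_UNIV sets_eq_borel)
  then have "emeasure m U * emeasure m V = 0"
    using UV by (simp add: emeasure_pair_measure_Times sets_eq_borel)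
  then show False
    using emeasure_open_pos[OF \<open>open U\<close> \<open>s \<in> U\<close>] emeasure_open_pos[OF \<open>open V\<close> \<open>t \<in> V\<close>] by auto
qed

end

section \<open>The class \<open>G\<close>\<close>

locale G_function =
  fixes a b :: real and \<phi> :: "real \<Rightarrow> real"
  assumes G: "\<phi> \<in> G_class a b" and a_nonneg: "0 \<le> a" and b_nonneg: "0 \<le> b"
begin

lemma phi_zero: "\<phi> 0 = 0"
  using G by (simp add: G_class_def)

lemma phi_less_iff: "0 \<le> x \<Longrightarrow> 0 \<le> y \<Longrightarrow> \<phi> x < \<phi> y \<longleftrightarrow> x < y"
  using G by (auto simp: G_class_def strict_mono_on_less)

lemma phi_le_iff: "0 \<le> x \<Longrightarrow> 0 \<le> y \<Longrightarrow> \<phi> x \<le> \<phi> y \<longleftrightarrow> x \<le> y"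
  using phi_less_iff[of y x] by (simp add: not_less[symmetric])

lemma phi_nonneg: "0 \<le> x \<Longrightarrow> 0 \<le> \<phi> x"
  using phi_le_iff[of 0 x] by (simp add: phi_zero)

lemma
  assumes "0 \<le> z"
  shows phi_inv_nonneg: "\<phi> (inv_nonneg \<phi> z) = z" and inv_nonneg_ge_0: "0 \<le> inv_nonneg \<phi> z"
proof -
  have "z \<in> \<phi> ` {0..}" using G assms by (simp add: G_class_def)
  then show "\<phi> (inv_nonneg \<phi> z) = z" "0 \<le> inv_nonneg \<phi> z"
    unfolding inv_nonneg_def using inv_into_into[of z \<phi> "{0..}"] by (simp_all add: f_inv_into_f)
qed

lemma le_inv_nonneg_iff: "0 \<le> y \<Longrightarrow> 0 \<le> z \<Longrightarrow> y \<le> inv_nonneg \<phi> z \<longleftrightarrow> \<phi> y \<le> z"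
  using phi_le_iff[of y "inv_nonneg \<phi> z"] by (simp add: phi_inv_nonneg inv_nonneg_ge_0)

lemma inv_nonneg_le_iff: "0 \<le> y \<Longrightarrow> 0 \<le> z \<Longrightarrow> inv_nonneg \<phi> z \<le> y \<longleftrightarrow> z \<le> \<phi> y"
  using phi_le_iff[of "inv_nonneg \<phi> z" y] by (simp add: phi_inv_nonneg inv_nonneg_ge_0)

lemma inv_nonneg_one_pos: "0 < inv_nonneg \<phi> 1"
  using inv_nonneg_le_iff[of 0 1] by (simp add: phi_zero not_le[symmetric])

lemma growth: "0 \<le> x \<Longrightarrow> inv_nonneg \<phi> 1 \<le> y \<Longrightarrow> x \<le> a + b * (\<phi> (x * y) / \<phi> y)"
  using G by (auto simp: G_class_def)

lemma b_pos: "0 < b"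
proof (rule ccontr)
  assume "\<not> 0 < b"
  then have "a + 1 \<le> a"
    using growth[of "a + 1" "inv_nonneg \<phi> 1"] a_nonneg b_nonneg by simp
  then show False by simp
qed

lemma le_growth:
  assumes q: "0 \<le> q" and y: "inv_nonneg \<phi> 1 \<le> y" and p: "1 \<le> \<phi> y * p"
  shows "q \<le> y * (a + b * p * \<phi> q)"
proof -
  have "0 < y" using y inv_nonneg_one_pos by linarith
  then have "0 < \<phi> y" using phi_less_iff[of 0 y] by (simp add: phi_zero)
  have "q / y \<le> a + b * (\<phi> (q / y * y) / \<phi> y)"
    using q y \<open>0 < y\<close> by (intro growth) simp_all
  also have "\<dots> = a + b * (\<phi> q * (1 / \<phi> y))" using \<open>0 < y\<close> by simp
  also have "\<dots> \<le> a + b * (\<phi> q * p)"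
    using p \<open>0 < \<phi> y\<close> b_nonneg phi_nonneg[OF q]
    by (intro add_left_mono mult_left_mono) (simp_all add: field_simps)
  finally show ?thesis using \<open>0 < y\<close> by (simp add: field_simps)
qed

lemma abs_diff_le_growth:
  fixes f :: "'a::metric_space \<Rightarrow> real"
  assumes "dist u v \<le> r" "inv_nonneg \<phi> 1 \<le> y" "1 \<le> \<phi> y * p"
  shows "\<bar>f u - f v\<bar> \<le> r * y * (a + b * p * \<phi> (\<bar>f u - f v\<bar> / dist u v))"
proof -
  define q where "q = \<bar>f u - f v\<bar> / dist u v"
  have "0 \<le> q" by (simp add: q_def)
  have "\<bar>f u - f v\<bar> = dist u v * q" by (simp add: q_def)
  also have "\<dots> \<le> r * (y * (a + b * p * \<phi> q))"
    using assms \<open>0 \<le> q\<close> order_trans[OF zero_le_dist assms(1)]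
    by (intro mult_mono le_growth) simp_all
  finally show ?thesis by (simp add: q_def mult.assoc)
qed

definition phi_slope :: "('a::metric_space \<Rightarrow> real) \<Rightarrow> 'a \<times> 'a \<Rightarrow> ennreal" where
  "phi_slope f = (\<lambda>(u, v). ennreal (\<phi> (\<bar>f u - f v\<bar> / dist u v)))"

lemma phi_slope_mono:
  assumes "\<And>u v. \<bar>g u - g v\<bar> \<le> \<bar>f u - f v\<bar>"
  shows "phi_slope g z \<le> phi_slope f z"
  using assms
  by (auto simp: phi_slope_def case_prod_beta phi_le_iff intro!: ennreal_leI divide_right_mono)

lemma phi_slope_eq_0_iff: "phi_slope f (u, v) = 0 \<longleftrightarrow> f u = f v"
proof (cases "u = v")
  case False
  then have "phi_slope f (u, v) = 0 \<longleftrightarrow> \<bar>f u - f v\<bar> / dist u v \<le> 0"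
    using phi_le_iff[of "\<bar>f u - f v\<bar> / dist u v" 0]
    by (simp add: phi_slope_def ennreal_eq_0_iff phi_zero)
  with False show ?thesis by (simp add: divide_le_0_iff)
qed (simp add: phi_slope_def phi_zero)

lemma phi_slope_measurable:
  fixes f :: "'a::metric_space \<Rightarrow> real"
  assumes sets: "sets M = sets (borel :: ('a \<times> 'a) measure)" and f: "continuous_on UNIV f"
  shows "phi_slope f \<in> borel_measurable M"
proof -
  have "continuous_on {0..} \<phi>" using G by (simp add: G_class_def)
  then have "continuous_on UNIV (\<lambda>x. \<phi> (max 0 x))"
    by (rule continuous_on_compose2) (auto intro!: continuous_intros)
  then have [measurable]: "(\<lambda>x. \<phi> (max 0 x)) \<in> borel_measurable borel"
    by (rule borel_measurable_continuous_onI)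
  have [measurable]: "(\<lambda>z. \<bar>f (fst z) - f (snd z)\<bar>) \<in> borel_measurable M"
    "(\<lambda>z. dist (fst z) (snd z)) \<in> borel_measurable M"
    by (intro measurable_continuous_sets_eq_borel[OF sets] continuous_intros
        continuous_on_compose2[OF f] subset_UNIV)+
  have "(\<lambda>z. ennreal (\<phi> (max 0 (\<bar>f (fst z) - f (snd z)\<bar> / dist (fst z) (snd z)))))
      \<in> borel_measurable M"
    by measurable
  then show ?thesis by (simp add: phi_slope_def case_prod_beta max_def)
qed

end

section \<open>The radius of a ball of prescribed mass\<close>

definition mass_radius :: "'a::metric_space measure \<Rightarrow> real \<Rightarrow> 'a \<Rightarrow> real" where
  "mass_radius M p x = Inf {r. 0 \<le> r \<and> p \<le> measure M (cball x r)}"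

lemma mass_radius_le: "0 \<le> r \<Longrightarrow> p \<le> measure M (cball x r) \<Longrightarrow> mass_radius M p x \<le> r"
  unfolding mass_radius_def by (rule cInf_lower) (auto intro!: bdd_belowI[of _ 0])

lemma dist_le_ediam: "s \<in> X \<Longrightarrow> t \<in> X \<Longrightarrow> ennreal (dist s t) \<le> ediam X"
  unfolding ediam_def by (intro SUP_upper2[of s] SUP_upper2[of t]) auto

lemma (in borel_prob_space) LIMSEQ_measure_cball:
  "(\<lambda>n. measure m (cball x (r + 1 / Suc n))) \<longlonglongrightarrow> measure m (cball x r)"
proof -
  have "decseq (\<lambda>n. cball x (r + 1 / Suc n))"
    by (intro decseq_SucI subset_cball) (simp add: field_simps)
  then have "(\<lambda>n. measure m (cball x (r + 1 / Suc n))) \<longlonglongrightarrow> measure m (\<Inter>n. cball x (r + 1 / Suc n))"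
    by (intro finite_Lim_measure_decseq) auto
  also have "(\<Inter>n. cball x (r + 1 / Suc n)) = cball x r"
  proof (intro equalityI subsetI)
    fix z assume z: "z \<in> (\<Inter>n. cball x (r + 1 / Suc n))"
    have "dist x z \<le> r"
    proof (rule field_le_epsilon)
      fix e :: real assume "0 < e"
      then obtain n :: nat where "1 / Suc n < e" using nat_approx_posE by blast
      moreover have "dist x z \<le> r + 1 / Suc n" using z by simp
      ultimately show "dist x z \<le> r + e" by linarith
    qed
    then show "z \<in> cball x r" by simp
  qed (auto intro: add_increasing2)
  finally show ?thesis .
qed

locale bounded_borel_prob_space = borel_prob_space +
  assumes bounded_UNIV: "bounded (UNIV :: 'a set)"
begin

lemma cball_eq_space: "(\<And>y. dist x y \<le> r) \<Longrightarrow> cball x r = space m"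
  by (auto simp: space_eq_UNIV)

lemma mass_radius_greatest:
  assumes "p \<le> 1" and "\<And>r. 0 \<le> r \<Longrightarrow> p \<le> measure m (cball x r) \<Longrightarrow> z \<le> r"
  shows "z \<le> mass_radius m p x"
proof -
  obtain r where r: "\<And>y. dist x y \<le> r"
    using bounded_UNIV bounded_any_center[of UNIV x] by auto
  then have "p \<le> measure m (cball x r)" "0 \<le> r"
    using assms(1) r[of x] by (simp_all add: cball_eq_space prob_space)
  then show ?thesis
    unfolding mass_radius_def using assms(2) by (intro cInf_greatest) auto
qed

lemma mass_radius_nonneg: "p \<le> 1 \<Longrightarrow> 0 \<le> mass_radius m p x"
  by (rule mass_radius_greatest)

lemma measure_cball_mass_radius:
  assumes "p \<le> 1"
  shows "p \<le> measure m (cball x (mass_radius m p x))"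
proof (rule LIMSEQ_le_const[OF LIMSEQ_measure_cball], intro exI allI impI)
  fix n :: nat
  have "\<exists>r. p \<le> measure m (cball x r) \<and> r < mass_radius m p x + 1 / Suc n"
  proof (rule ccontr)
    assume "\<not> ?thesis"
    then have "mass_radius m p x + 1 / Suc n \<le> mass_radius m p x"
      using assms by (intro mass_radius_greatest) (auto simp: not_less)
    then show False by simp
  qed
  then obtain r where r: "p \<le> measure m (cball x r)" "r < mass_radius m p x + 1 / Suc n" by blast
  note r(1)
  also have "measure m (cball x r) \<le> measure m (cball x (mass_radius m p x + 1 / Suc n))"
    using r by (intro finite_measure_mono subset_cball) auto
  finally show "p \<le> measure m (cball x (mass_radius m p x + 1 / Suc n))" by simp
qed

lemma mass_radius_le_add_dist:
  assumes "p \<le> 1"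
  shows "mass_radius m p x \<le> mass_radius m p y + dist x y"
proof (rule mass_radius_le)
  have "p \<le> measure m (cball y (mass_radius m p y))"
    by (rule measure_cball_mass_radius[OF assms])
  also have "\<dots> \<le> measure m (cball x (mass_radius m p y + dist x y))"
    by (intro finite_measure_mono) (auto intro!: order_trans[OF dist_triangle[of x _ y]])
  finally show "p \<le> measure m (cball x (mass_radius m p y + dist x y))" .
qed (simp add: mass_radius_nonneg assms)

lemma continuous_mass_radius:
  assumes "p \<le> 1"
  shows "continuous_on UNIV (mass_radius m p)"
proof -
  have "1-lipschitz_on UNIV (mass_radius m p)"
    using mass_radius_le_add_dist[OF assms]
    by (intro lipschitz_onI)
      (simp_all add: dist_real_def abs_le_iff diff_le_eq add.commute, metis dist_commute)
  then show ?thesis by (rule lipschitz_on_continuous_on)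
qed

lemma le_ediam_if_less_mass_radius:
  assumes "0 < e" "e < mass_radius m p x" "p \<le> 1"
  shows "ennreal e \<le> ediam (UNIV :: 'a set)"
proof (rule ccontr)
  assume less: "\<not> ?thesis"
  have "dist x y \<le> e" for y
  proof -
    have "ennreal (dist x y) \<le> ediam (UNIV :: 'a set)" by (rule dist_le_ediam) simp_all
    also have "\<dots> \<le> ennreal e" using less by simp
    finally show ?thesis using \<open>0 < e\<close> by (simp add: ennreal_le_iff)
  qed
  then have "measure m (cball x e) = 1" by (simp add: cball_eq_space prob_space)
  then have "mass_radius m p x \<le> e" using assms by (intro mass_radius_le) simp_all
  then show False using assms by simp
qed

end

section \<open>Comparison with the majorizing integral\<close>

locale G_levels = G_function +
  fixes R :: real
  assumes R_gt_1: "1 < R"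
begin

definition level :: "nat \<Rightarrow> real" where
  "level k = inv_nonneg \<phi> 1 * R ^ k"

lemma level_pos: "0 < level k"
  using inv_nonneg_one_pos R_gt_1 by (simp add: level_def)

lemma level_nonneg: "0 \<le> level k"
  using level_pos by (rule less_imp_le)

lemma level_Suc: "level (Suc k) = R * level k"
  by (simp add: level_def)

lemma level_ge: "inv_nonneg \<phi> 1 \<le> level k"
  using inv_nonneg_one_pos R_gt_1 by (simp add: level_def)

lemma phi_level_0: "\<phi> (level 0) = 1"
  by (simp add: level_def phi_inv_nonneg)

lemma phi_level_ge_1: "1 \<le> \<phi> (level k)"
  using inv_nonneg_le_iff[OF level_nonneg, of 1] level_ge by simp

lemma sum_level: "(\<Sum>k<n. level k) = (level n - level 0) / (R - 1)"
proof -
  have "(R - 1) * (\<Sum>k<n. level k) = level n - level 0"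
    by (induction n) (simp_all add: level_Suc algebra_simps)
  then show ?thesis using R_gt_1 by (simp add: field_simps)
qed

lemma sum_level_Suc_le: "(\<Sum>k<n. level (Suc k)) \<le> level (Suc n) / (R - 1)"
proof -
  have "(\<Sum>k<n. level (Suc k)) = R * (\<Sum>k<n. level k)"
    by (simp add: level_Suc sum_distrib_left)
  also have "\<dots> \<le> level (Suc n) / (R - 1)"
    using R_gt_1 level_nonneg[of 0]
    by (simp add: sum_level level_Suc divide_right_mono mult_left_mono)
  finally show ?thesis .
qed

lemma sum_level_bounded_le:
  assumes "0 \<le> h"
  shows "(\<Sum>k | k < n \<and> level k \<le> h. level (Suc k)) \<le> R\<^sup>2 / (R - 1) * h"
proof (induction n)
  case 0
  then show ?case using assms R_gt_1 by simp
next
  case (Suc n)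
  show ?case
  proof (cases "level n \<le> h")
    case True
    have "(\<Sum>k | k < Suc n \<and> level k \<le> h. level (Suc k)) \<le> (\<Sum>k<Suc n. level (Suc k))"
      using level_nonneg by (intro sum_mono2) auto
    also have "\<dots> \<le> level (Suc (Suc n)) / (R - 1)" by (rule sum_level_Suc_le)
    also have "\<dots> = R\<^sup>2 / (R - 1) * level n" by (simp add: level_Suc power2_eq_square)
    also have "\<dots> \<le> R\<^sup>2 / (R - 1) * h" using True R_gt_1 by (intro mult_left_mono) simp_all
    finally show ?thesis .
  next
    case False
    then have "{k. k < Suc n \<and> level k \<le> h} = {k. k < n \<and> level k \<le> h}"
      using less_Suc_eq by auto
    then show ?thesis using Suc by simp
  qed
qed

definition absorbing :: "real \<Rightarrow> bool" where
  "absorbing K \<longleftrightarrow> 0 \<le> K \<and> a + K / (R - 1) \<le> K"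

lemma B_const_pos: "0 < B_const R" and B_const_finite: "B_const R < \<infinity>"
  using R_gt_1 by (auto simp: B_const_def)

lemma B_const_mult_divide: "B_const R * (x / B_const R) = x"
  using B_const_pos B_const_finite
  by (simp add: ennreal_times_divide mult_divide_eq_ennreal mult.commute[of "B_const R"])

end

locale chaining = full_support_prob_space m + G_levels a b \<phi> R
  for m :: "'a::metric_space measure" and a b R :: real and \<phi> :: "real \<Rightarrow> real"
begin

lemma phi_slope_measurable_pair:
  "continuous_on UNIV f \<Longrightarrow> phi_slope f \<in> borel_measurable (m \<Otimes>\<^sub>M m)"
  by (rule phi_slope_measurable[OF sets_pair_eq_borel])

lemma sigma_ge: "ennreal (inv_nonneg \<phi> 1 * dist (s :: 'a) t) \<le> sigma_fun \<phi> m x"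
proof -
  have "ennreal (inv_nonneg \<phi> 1 * dist s t)
      = (\<integral>\<^sup>+e. ennreal (inv_nonneg \<phi> 1) * indicator {0<..dist s t} e \<partial>lborel)"
    using inv_nonneg_one_pos by (simp add: nn_integral_cmult_indicator ennreal_mult)
  also have "\<dots> \<le> sigma_fun \<phi> m x"
    unfolding sigma_fun_def
  proof (intro nn_integral_mono)
    fix e :: real
    show "ennreal (inv_nonneg \<phi> 1) * indicator {0<..dist s t} e
      \<le> ennreal (inv_nonneg \<phi> (1 / measure m (cball x e))) *
        indicator {e. 0 < e \<and> ennreal e \<le> ediam (UNIV :: 'a set)} e"
    proof (cases "e \<in> {0<..dist s t}")
      case True
      then have "0 < measure m (cball x e)" by (intro measure_cball_pos) simp
      then have "inv_nonneg \<phi> 1 \<le> inv_nonneg \<phi> (1 / measure m (cball x e))"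
        by (subst le_inv_nonneg_iff) (simp_all add: inv_nonneg_ge_0 phi_inv_nonneg)
      moreover have "ennreal e \<le> ediam (UNIV :: 'a set)"
        using True dist_le_ediam[of s UNIV t] by (auto intro: order_trans[OF ennreal_leI])
      ultimately show ?thesis using True by (simp add: ennreal_leI)
    qed simp
  qed
  finally show ?thesis .
qed

lemma S_sup_ge: "ennreal (inv_nonneg \<phi> 1 * dist (s :: 'a) t) \<le> S_sup \<phi> m"
  unfolding S_sup_def by (intro SUP_upper2[of s] sigma_ge) simp

lemma S_bar_ge: "ennreal (inv_nonneg \<phi> 1 * dist (s :: 'a) t) \<le> S_bar \<phi> m"
proof -
  have "(\<integral>\<^sup>+u. ennreal (inv_nonneg \<phi> 1 * dist s t) \<partial>m) \<le> S_bar \<phi> m"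
    unfolding S_bar_def by (intro nn_integral_mono sigma_ge)
  then show ?thesis by (simp add: emeasure_space_1)
qed

lemma bounded_if_S_bar_finite:
  assumes "S_bar \<phi> m < \<infinity>"
  shows "bounded (UNIV :: 'a set)"
proof -
  have "dist x y \<le> enn2real (S_bar \<phi> m) / inv_nonneg \<phi> 1" for x y :: 'a
  proof -
    have "ennreal (inv_nonneg \<phi> 1 * dist x y) \<le> ennreal (enn2real (S_bar \<phi> m))"
      using S_bar_ge[of x y] assms by simp
    then show ?thesis using inv_nonneg_one_pos by (simp add: field_simps)
  qed
  then show ?thesis unfolding bounded_def by blast
qed

end

locale bounded_chaining = chaining + bounded_borel_prob_space
begin

definition radius :: "nat \<Rightarrow> 'a \<Rightarrow> real" where
  "radius k = mass_radius m (1 / \<phi> (level k))"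

lemma mass_le_1: "1 / \<phi> (level k) \<le> 1"
  using phi_level_ge_1[of k] by simp

lemma radius_nonneg: "0 \<le> radius k x"
  unfolding radius_def by (rule mass_radius_nonneg[OF mass_le_1])

lemma radius_le_add_dist: "radius k x \<le> radius k y + dist x y"
  unfolding radius_def by (rule mass_radius_le_add_dist[OF mass_le_1])

lemma continuous_radius: "continuous_on UNIV (radius k)"
  unfolding radius_def by (rule continuous_mass_radius[OF mass_le_1])

lemma measure_cball_radius: "1 \<le> \<phi> (level k) * measure m (cball x (radius k x))"
  using measure_cball_mass_radius[OF mass_le_1, of k x] phi_level_ge_1[of k]
  by (simp add: radius_def field_simps)

lemma measure_cball_radius_pos: "0 < measure m (cball x (radius k x))"
  using measure_cball_radius[of k x]
  by (simp add: zero_less_measure_iff) (metis mult_zero_right not_one_le_zero)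

lemma measure_cball_radius_0: "measure m (cball x (radius 0 x)) = 1"
  using measure_cball_radius[of 0 x] prob_le_1[of "cball x (radius 0 x)"] by (simp add: phi_level_0)

lemma ex_radius_le:
  assumes "0 < e"
  shows "\<exists>n. radius n x \<le> e"
proof -
  define p where "p = measure m (cball x e)"
  have "0 < p" using measure_cball_pos[OF assms] by (simp add: p_def)
  obtain n where "inv_nonneg \<phi> (1 / p) / inv_nonneg \<phi> 1 < R ^ n"
    using real_arch_pow[OF R_gt_1] by blast
  then have "inv_nonneg \<phi> (1 / p) \<le> level n"
    using inv_nonneg_one_pos by (simp add: level_def field_simps)
  then have "1 / p \<le> \<phi> (level n)"
    using \<open>0 < p\<close> by (simp add: inv_nonneg_le_iff level_nonneg)
  then have "1 / \<phi> (level n) \<le> p"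
    using \<open>0 < p\<close> phi_level_ge_1[of n] by (simp add: field_simps)
  then show ?thesis
    unfolding radius_def p_def using assms by (intro exI mass_radius_le) simp_all
qed

lemma level_le_integrand:
  assumes "0 < e" "e < radius k x"
  shows "level k \<le> inv_nonneg \<phi> (1 / measure m (cball x e))"
proof -
  have "0 < measure m (cball x e)" using assms(1) by (rule measure_cball_pos)
  moreover have "measure m (cball x e) < 1 / \<phi> (level k)"
    using assms mass_radius_le[of e "1 / \<phi> (level k)" m x] unfolding radius_def by force
  ultimately show ?thesis
    using phi_level_ge_1[of k] by (simp add: le_inv_nonneg_iff level_nonneg field_simps)
qed

definition weight :: "nat \<Rightarrow> 'a \<Rightarrow> real" where
  "weight k x = level (Suc k) * radius k x"

lemma weight_nonneg: "0 \<le> weight k x"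
  by (simp add: weight_def level_nonneg radius_nonneg)

lemma continuous_weight: "continuous_on UNIV (weight k)"
  unfolding weight_def by (intro continuous_intros continuous_radius)

lemma suminf_level_indicator_le:
  "(\<Sum>k. ennreal (level (Suc k)) * indicator {0<..<radius k x} e) / B_const R
    \<le> ennreal (inv_nonneg \<phi> (1 / measure m (cball x e))) *
      indicator {e. 0 < e \<and> ennreal e \<le> ediam (UNIV :: 'a set)} e"
proof (cases "\<exists>k. e \<in> {0<..<radius k x}")
  case True
  define h where "h = inv_nonneg \<phi> (1 / measure m (cball x e))"
  have "0 < e" "ennreal e \<le> ediam (UNIV :: 'a set)"
    using True le_ediam_if_less_mass_radius[OF _ _ mass_le_1] by (auto simp: radius_def)
  have "0 \<le> h" unfolding h_def by (rule inv_nonneg_ge_0) simp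
  have "(\<Sum>k. ennreal (level (Suc k)) * indicator {0<..<radius k x} e) \<le> B_const R * ennreal h"
  proof (rule suminf_le_const)
    fix n
    have "(\<Sum>k<n. ennreal (level (Suc k)) * indicator {0<..<radius k x} e)
        = (\<Sum>k | k < n \<and> e < radius k x. ennreal (level (Suc k)))"
      using \<open>0 < e\<close> by (intro sum.mono_neutral_cong_right) auto
    also have "\<dots> \<le> (\<Sum>k | k < n \<and> level k \<le> h. ennreal (level (Suc k)))"
      using level_le_integrand[OF \<open>0 < e\<close>] by (intro sum_mono2) (auto simp: h_def)
    also have "\<dots> = ennreal (\<Sum>k | k < n \<and> level k \<le> h. level (Suc k))"
      by (simp add: level_nonneg)
    also have "\<dots> \<le> ennreal (R\<^sup>2 / (R - 1) * h)"
      by (intro ennreal_leI sum_level_bounded_le \<open>0 \<le> h\<close>)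
    also have "\<dots> = B_const R * ennreal h"
      using R_gt_1 by (subst ennreal_mult') (simp_all add: B_const_def)
    finally show "(\<Sum>k<n. ennreal (level (Suc k)) * indicator {0<..<radius k x} e)
      \<le> B_const R * ennreal h" .
  qed simp
  then show ?thesis
    using \<open>0 < e\<close> \<open>ennreal e \<le> _\<close> by (simp add: h_def divide_le_posI_ennreal B_const_pos)
next
  case False
  then show ?thesis by simp
qed

lemma suminf_weight_le_sigma: "(\<Sum>k. ennreal (weight k x)) / B_const R \<le> sigma_fun \<phi> m x"
proof -
  have "(\<Sum>k. ennreal (weight k x))
      = (\<Sum>k. \<integral>\<^sup>+e. ennreal (level (Suc k)) * indicator {0<..<radius k x} e \<partial>lborel)"
    by (simp add: weight_def nn_integral_cmult_indicator ennreal_mult level_nonneg radius_nonneg)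
  also have "\<dots> = (\<integral>\<^sup>+e. (\<Sum>k. ennreal (level (Suc k)) * indicator {0<..<radius k x} e) \<partial>lborel)"
    by (intro nn_integral_suminf[symmetric]) measurable
  finally have "(\<Sum>k. ennreal (weight k x)) / B_const R
      = (\<integral>\<^sup>+e. (\<Sum>k. ennreal (level (Suc k)) * indicator {0<..<radius k x} e) / B_const R \<partial>lborel)"
    by (simp add: nn_integral_divide)
  also have "\<dots> \<le> sigma_fun \<phi> m x"
    unfolding sigma_fun_def by (intro nn_integral_mono suminf_level_indicator_le)
  finally show ?thesis .
qed

end

section \<open>Averages over balls\<close>

lemma (in prob_space) ennreal_abs_expectation_diff_le:
  assumes "integrable M f"
  shows "ennreal \<bar>expectation f - c\<bar> \<le> (\<integral>\<^sup>+x. ennreal \<bar>f x - c\<bar> \<partial>M)"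
proof -
  have diff: "expectation (\<lambda>x. f x - c) = expectation f - c"
    using assms prob_space by simp
  have "integrable M (\<lambda>x. f x - c)" using assms by simp
  from integral_norm_bound_ennreal[OF this] show ?thesis unfolding diff real_norm_def .
qed

lemma (in prob_space) uniform_measure_eq_self:
  assumes [measurable]: "A \<in> events" and "prob A = 1"
  shows "uniform_measure M A = M"
proof (rule measure_eqI)
  fix B assume "B \<in> sets (uniform_measure M A)"
  then have [measurable]: "B \<in> events" by simp
  have "AE x in M. x \<in> A" using assms by (simp add: AE_in_set_eq_1)
  then have "emeasure M (A \<inter> B) = emeasure M B"
    by (intro emeasure_eq_AE) auto
  then show "emeasure (uniform_measure M A) B = emeasure M B"
    using assms by (simp add: emeasure_eq_measure[of A] divide_ennreal_def)
qed simp

lemma (in finite_measure) nn_integral_uniform_measure_le: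
  assumes [measurable]: "A \<in> sets M" "h \<in> borel_measurable M"
  shows "ennreal (measure M A) * (\<integral>\<^sup>+x. h x \<partial>uniform_measure M A) \<le> (\<integral>\<^sup>+x. h x \<partial>M)"
proof (cases "measure M A = 0")
  case False
  then have A: "emeasure M A \<noteq> 0" by (simp add: emeasure_eq_measure)
  have "ennreal (measure M A) * (\<integral>\<^sup>+x. h x \<partial>uniform_measure M A)
      = (\<integral>\<^sup>+x. h x * indicator A x \<partial>M) * emeasure M A / emeasure M A"
    by (simp add: nn_integral_uniform_measure emeasure_eq_measure[symmetric] ennreal_times_divide
        mult.commute)
  also have "\<dots> = (\<integral>\<^sup>+x. h x * indicator A x \<partial>M)"
    using A by (intro mult_divide_eq_ennreal) auto
  also have "\<dots> \<le> (\<integral>\<^sup>+x. h x \<partial>M)"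
    by (intro nn_integral_mono) (simp add: indicator_def)
  finally show ?thesis .
qed simp

context full_support_prob_space
begin

definition ball_kernel :: "('a \<Rightarrow> real) \<Rightarrow> 'a \<times> 'a \<Rightarrow> ennreal" where
  "ball_kernel r = (\<lambda>(u, v). indicator (cball u (r u)) v / emeasure m (cball u (r u)))"

lemma ball_kernel_measurable:
  assumes r: "continuous_on UNIV r"
  shows "ball_kernel r \<in> borel_measurable (m \<Otimes>\<^sub>M m)"
proof -
  define E where "E = {z :: 'a \<times> 'a. dist (fst z) (snd z) \<le> r (fst z)}"
  have "continuous_on UNIV (\<lambda>z :: 'a \<times> 'a. r (fst z))"
    by (rule continuous_on_compose2[OF r]) (auto intro!: continuous_intros)
  then have "closed E"
    unfolding E_def by (intro closed_Collect_le continuous_intros)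
  then have [measurable]: "E \<in> sets (m \<Otimes>\<^sub>M m)" by (simp add: sets_pair_eq_borel)
  have E: "indicator (cball u (r u)) v = (indicator E (u, v) :: ennreal)" for u v
    by (simp add: E_def indicator_def)
  have "(\<lambda>u. \<integral>\<^sup>+v. indicator E (u, v) \<partial>m) \<in> borel_measurable m"
    by measurable
  moreover have "(\<integral>\<^sup>+v. indicator E (u, v) \<partial>m) = emeasure m (cball u (r u))" for u
    by (simp flip: E)
  ultimately have [measurable]: "(\<lambda>u. emeasure m (cball u (r u))) \<in> borel_measurable m"
    by simp
  show ?thesis
    unfolding ball_kernel_def E by measurable
qed

lemma nn_integral_ball_kernel:
  assumes [measurable]: "g \<in> borel_measurable m"
  shows "(\<integral>\<^sup>+v. ball_kernel r (u, v) * g v \<partial>m) = (\<integral>\<^sup>+v. g v \<partial>uniform_measure m (cball u (r u)))"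
proof -
  have "(\<integral>\<^sup>+v. ball_kernel r (u, v) * g v \<partial>m)
      = (\<integral>\<^sup>+v. (g v * indicator (cball u (r u)) v) / emeasure m (cball u (r u)) \<partial>m)"
    by (intro nn_integral_cong) (simp add: ball_kernel_def divide_ennreal_def ac_simps)
  then show ?thesis by (simp add: nn_integral_divide nn_integral_uniform_measure)
qed

lemma nn_integral_uniform_cball_measurable:
  assumes "continuous_on UNIV r" and g [measurable]: "g \<in> borel_measurable (m \<Otimes>\<^sub>M m)"
  shows "(\<lambda>u. \<integral>\<^sup>+v. g (u, v) \<partial>uniform_measure m (cball u (r u))) \<in> borel_measurable m"
proof -
  note [measurable] = ball_kernel_measurable[OF assms(1)]
  have "(\<lambda>u. \<integral>\<^sup>+v. ball_kernel r (u, v) * g (u, v) \<partial>m) \<in> borel_measurable m"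
    by measurable
  then show ?thesis by (simp add: nn_integral_ball_kernel[OF measurable_section[OF g]])
qed

lemma nn_integral_weighted_ball_kernel:
  assumes "continuous_on UNIV r" and [measurable]: "w \<in> borel_measurable m"
    and g [measurable]: "g \<in> borel_measurable (m \<Otimes>\<^sub>M m)"
  shows "(\<integral>\<^sup>+z. w (fst z) * ball_kernel r z * g z \<partial>(m \<Otimes>\<^sub>M m))
    = (\<integral>\<^sup>+u. w u * (\<integral>\<^sup>+v. g (u, v) \<partial>uniform_measure m (cball u (r u))) \<partial>m)"
proof -
  note [measurable] = ball_kernel_measurable[OF assms(1)]
  have "(\<integral>\<^sup>+z. w (fst z) * ball_kernel r z * g z \<partial>(m \<Otimes>\<^sub>M m))
      = (\<integral>\<^sup>+u. \<integral>\<^sup>+v. w u * (ball_kernel r (u, v) * g (u, v)) \<partial>m \<partial>m)"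
    by (subst nn_integral_fst[symmetric]) (simp_all add: mult.assoc)
  also have "\<dots> = (\<integral>\<^sup>+u. w u * (\<integral>\<^sup>+v. ball_kernel r (u, v) * g (u, v) \<partial>m) \<partial>m)"
    by (intro nn_integral_cong nn_integral_cmult) measurable
  finally show ?thesis by (simp add: nn_integral_ball_kernel measurable_section[OF g])
qed

end

section \<open>Chaining by local means\<close>

context bounded_chaining
begin

abbreviation local_unif :: "nat \<Rightarrow> 'a \<Rightarrow> 'a measure" where
  "local_unif k x \<equiv> uniform_measure m (cball x (radius k x))"

definition local_mean :: "nat \<Rightarrow> ('a \<Rightarrow> real) \<Rightarrow> 'a \<Rightarrow> real" where
  "local_mean k f x = (\<integral>v. f v \<partial>local_unif k x)"

definition local_energy :: "nat \<Rightarrow> ('a \<Rightarrow> real) \<Rightarrow> 'a \<Rightarrow> ennreal" where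
  "local_energy k f u = ennreal (weight k u) * (\<integral>\<^sup>+v. phi_slope f (u, v) \<partial>local_unif k u)"

definition energy :: "nat \<Rightarrow> ('a \<Rightarrow> real) \<Rightarrow> ennreal" where
  "energy k f = (\<integral>\<^sup>+u. local_energy k f u \<partial>m)"

lemma weight_measurable [measurable]: "weight k \<in> borel_measurable m"
  by (rule measurable_continuous[OF continuous_weight])

lemma prob_space_local_unif: "prob_space (local_unif k x)"
  using measure_cball_radius_pos[of x k]
  by (intro prob_space_uniform_measure) (simp_all add: emeasure_eq_measure)

lemma AE_local_unif: "(\<And>v. dist x v \<le> radius k x \<Longrightarrow> P v) \<Longrightarrow> AE v in local_unif k x. P v"
  by (rule AE_uniform_measureI) auto

lemma nn_integral_local_unif_affine_le:
  assumes [measurable]: "h \<in> borel_measurable m"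
    and le: "\<And>v. dist x v \<le> radius k x \<Longrightarrow> g v \<le> c + d * h v"
  shows "(\<integral>\<^sup>+v. g v \<partial>local_unif k x) \<le> c + d * (\<integral>\<^sup>+v. h v \<partial>local_unif k x)"
proof -
  interpret U: prob_space "local_unif k x" by (rule prob_space_local_unif)
  have "(\<integral>\<^sup>+v. g v \<partial>local_unif k x) \<le> (\<integral>\<^sup>+v. c + d * h v \<partial>local_unif k x)"
    by (intro nn_integral_mono_AE AE_local_unif le)
  also have "\<dots> = c + d * (\<integral>\<^sup>+v. h v \<partial>local_unif k x)"
    by (subst nn_integral_add) (auto simp: nn_integral_cmult U.emeasure_space_1[simplified])
  finally show ?thesis .
qed

lemma local_energy_measurable:
  assumes "continuous_on UNIV f"
  shows "local_energy k f \<in> borel_measurable m"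
proof -
  have [measurable]: "(\<lambda>u. \<integral>\<^sup>+v. phi_slope f (u, v) \<partial>local_unif k u) \<in> borel_measurable m"
    using assms
    by (intro nn_integral_uniform_cball_measurable continuous_radius phi_slope_measurable_pair)
  show ?thesis unfolding local_energy_def by measurable
qed

lemma local_mean_0: "local_mean 0 f x = expectation f"
  by (simp add: local_mean_def uniform_measure_eq_self measure_cball_radius_0)

lemma abs_local_mean_diff_le:
  assumes "continuous_on UNIV f" "bounded (range f)"
  shows "ennreal \<bar>local_mean k f x - c\<bar> \<le> (\<integral>\<^sup>+v. ennreal \<bar>f v - c\<bar> \<partial>local_unif k x)"
proof -
  interpret U: prob_space "local_unif k x" by (rule prob_space_local_unif)
  obtain C where "\<And>v. \<bar>f v\<bar> \<le> C" using assms(2) by (auto simp: bounded_iff)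
  moreover have "f \<in> borel_measurable (local_unif k x)"
    using measurable_continuous[OF assms(1)] by simp
  ultimately have "integrable (local_unif k x) f"
    by (intro U.integrable_const_bound[of _ C]) auto
  then show ?thesis
    unfolding local_mean_def by (rule U.ennreal_abs_expectation_diff_le)
qed

lemma abs_local_mean_increment_le:
  assumes f: "continuous_on UNIV f" "bounded (range f)" and p: "1 \<le> \<phi> (level (Suc k)) * p"
  shows "ennreal \<bar>local_mean k f u - f u\<bar>
    \<le> ennreal (a * weight k u) + ennreal b * (ennreal p * local_energy k f u)"
proof -
  have "0 \<le> p"
    using p phi_level_ge_1[of "Suc k"] zero_le_mult_iff[of "\<phi> (level (Suc k))" p] by linarith
  have [measurable]: "(\<lambda>v. phi_slope f (u, v)) \<in> borel_measurable m"
    by (rule measurable_section[OF phi_slope_measurable_pair[OF f(1)]])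
  have "ennreal \<bar>f v - f u\<bar>
      \<le> ennreal (a * weight k u) + ennreal (b * p * weight k u) * phi_slope f (u, v)"
    if "dist u v \<le> radius k u" for v
  proof -
    let ?q = "\<bar>f u - f v\<bar> / dist u v"
    have "\<bar>f u - f v\<bar> \<le> radius k u * level (Suc k) * (a + b * p * \<phi> ?q)"
      by (rule abs_diff_le_growth[OF that level_ge p])
    then have "\<bar>f v - f u\<bar> \<le> a * weight k u + b * p * weight k u * \<phi> ?q"
      by (simp add: weight_def algebra_simps abs_minus_commute)
    then have "ennreal \<bar>f v - f u\<bar> \<le> ennreal (a * weight k u + b * p * weight k u * \<phi> ?q)"
      by (rule ennreal_leI)
    then show ?thesis
      using \<open>0 \<le> p\<close> a_nonneg b_nonneg weight_nonneg[of k u] phi_nonneg[of ?q]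
      by (simp add: phi_slope_def ennreal_mult)
  qed
  then have "(\<integral>\<^sup>+v. ennreal \<bar>f v - f u\<bar> \<partial>local_unif k u) \<le> ennreal (a * weight k u) +
      ennreal (b * p * weight k u) * (\<integral>\<^sup>+v. phi_slope f (u, v) \<partial>local_unif k u)"
    by (intro nn_integral_local_unif_affine_le) measurable
  also have "ennreal (b * p * weight k u) * (\<integral>\<^sup>+v. phi_slope f (u, v) \<partial>local_unif k u)
      = ennreal b * (ennreal p * local_energy k f u)"
    using \<open>0 \<le> p\<close> b_nonneg weight_nonneg[of k u]
    by (simp add: local_energy_def ennreal_mult mult.assoc)
  finally show ?thesis
    using abs_local_mean_diff_le[OF f] by (rule order_trans[rotated])
qed

definition chain_bound :: "nat \<Rightarrow> 'a \<Rightarrow> real" where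
  "chain_bound k x = (\<Sum>j<k. weight j x) + weight k x / (R - 1)"

lemma chain_bound_nonneg: "0 \<le> chain_bound k x"
  using R_gt_1 weight_nonneg by (simp add: chain_bound_def sum_nonneg)

lemma sum_weight_le_chain_bound:
  assumes "dist x u \<le> radius (Suc k) x"
  shows "(\<Sum>j<Suc k. weight j u) \<le> chain_bound (Suc k) x"
proof -
  have "weight j u \<le> weight j x + level (Suc j) * radius (Suc k) x" for j
  proof -
    have "radius j u \<le> radius j x + radius (Suc k) x"
      using radius_le_add_dist[of j u x] assms by (simp add: dist_commute)
    then show ?thesis
      using mult_left_mono[OF _ level_nonneg] by (simp add: weight_def flip: distrib_left)
  qed
  then have "(\<Sum>j<Suc k. weight j u) \<le> (\<Sum>j<Suc k. weight j x + level (Suc j) * radius (Suc k) x)"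
    by (rule sum_mono)
  also have "\<dots> = (\<Sum>j<Suc k. weight j x) + (\<Sum>j<Suc k. level (Suc j)) * radius (Suc k) x"
    by (simp only: sum.distrib sum_distrib_right)
  also have "\<dots> \<le> (\<Sum>j<Suc k. weight j x) + level (Suc (Suc k)) / (R - 1) * radius (Suc k) x"
    by (intro add_left_mono mult_right_mono sum_level_Suc_le radius_nonneg)
  also have "\<dots> = chain_bound (Suc k) x"
    by (simp add: chain_bound_def weight_def)
  finally show ?thesis .
qed

lemma chain_bound_step:
  assumes K: "absorbing K" and u: "dist x u \<le> radius (Suc k) x"
  shows "a * weight k u + K * chain_bound k u \<le> K * chain_bound (Suc k) x"
proof -
  have "a * weight k u + K * chain_bound k u
      = (a + K / (R - 1)) * weight k u + K * (\<Sum>j<k. weight j u)"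
    by (simp add: chain_bound_def algebra_simps)
  also have "\<dots> \<le> K * weight k u + K * (\<Sum>j<k. weight j u)"
    using K by (intro add_right_mono mult_right_mono weight_nonneg) (simp add: absorbing_def)
  also have "\<dots> = K * (\<Sum>j<Suc k. weight j u)"
    by (simp add: algebra_simps)
  also have "\<dots> \<le> K * chain_bound (Suc k) x"
    using K by (intro mult_left_mono sum_weight_le_chain_bound u) (simp add: absorbing_def)
  finally show ?thesis .
qed

lemma abs_diff_le_if_abs_local_mean_diff_le:
  assumes f: "continuous_on UNIV f" "bounded (range f)" and K: "absorbing K"
    and p: "1 \<le> \<phi> (level (Suc k)) * p" and u: "dist x u \<le> radius (Suc k) x"
    and mean_bound: "ennreal \<bar>local_mean k f u - c\<bar> \<le> ennreal (K * chain_bound k u) + Q"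
  shows "ennreal \<bar>f u - c\<bar>
    \<le> (ennreal (K * chain_bound (Suc k) x) + Q) + ennreal b * ennreal p * local_energy k f u"
proof -
  have "ennreal \<bar>f u - c\<bar> \<le> ennreal (\<bar>local_mean k f u - f u\<bar> + \<bar>local_mean k f u - c\<bar>)"
    by (intro ennreal_leI) simp
  also have "\<dots> = ennreal \<bar>local_mean k f u - f u\<bar> + ennreal \<bar>local_mean k f u - c\<bar>"
    by simp
  also have "\<dots> \<le> (ennreal (a * weight k u) + ennreal b * (ennreal p * local_energy k f u))
      + (ennreal (K * chain_bound k u) + Q)"
    by (intro add_mono mean_bound abs_local_mean_increment_le[OF f p])
  also have "\<dots> = ennreal (a * weight k u + K * chain_bound k u) + Q
      + ennreal b * ennreal p * local_energy k f u"
    using K a_nonneg weight_nonneg chain_bound_nonneg by (simp add: absorbing_def ac_simps)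
  also have "\<dots> \<le> (ennreal (K * chain_bound (Suc k) x) + Q) + ennreal b * ennreal p * local_energy k f u"
    by (intro add_right_mono ennreal_leI chain_bound_step K u)
  finally show ?thesis .
qed

lemma abs_local_mean_diff_expectation_le:
  assumes f: "continuous_on UNIV f" "bounded (range f)" and K: "absorbing K"
  shows "ennreal \<bar>local_mean k f x - expectation f\<bar>
    \<le> ennreal (K * chain_bound k x) + ennreal b * (\<Sum>j<k. energy j f)"
proof (induction k arbitrary: x)
  case 0
  then show ?case by (simp add: local_mean_0)
next
  case (Suc k)
  define Q where "Q = ennreal b * (\<Sum>j<k. energy j f)"
  define p where "p = measure m (cball x (radius (Suc k) x))"
  note [measurable] = local_energy_measurable[OF f(1)]
  have "ennreal \<bar>local_mean (Suc k) f x - expectation f\<bar>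
      \<le> (\<integral>\<^sup>+u. ennreal \<bar>f u - expectation f\<bar> \<partial>local_unif (Suc k) x)"
    by (rule abs_local_mean_diff_le[OF f])
  also have "\<dots> \<le> (ennreal (K * chain_bound (Suc k) x) + Q)
      + ennreal b * ennreal p * (\<integral>\<^sup>+u. local_energy k f u \<partial>local_unif (Suc k) x)"
    unfolding p_def Q_def
    by (intro nn_integral_local_unif_affine_le
        abs_diff_le_if_abs_local_mean_diff_le[OF f K measure_cball_radius] Suc.IH) measurable
  also have "\<dots> \<le> (ennreal (K * chain_bound (Suc k) x) + Q) + ennreal b * energy k f"
    unfolding p_def energy_def mult.assoc
    by (intro add_left_mono mult_left_mono nn_integral_uniform_measure_le) measurable
  finally show ?case
    by (simp add: Q_def distrib_left ac_simps)
qed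

lemma chain_bound_le_sigma:
  assumes K: "absorbing K"
  shows "ennreal (K * chain_bound n x) \<le> ennreal K * (B_const R * sigma_fun \<phi> m x)"
proof -
  have "K / (R - 1) * weight n x \<le> K * weight n x"
    using K a_nonneg by (intro mult_right_mono weight_nonneg) (simp add: absorbing_def)
  then have "K * chain_bound n x \<le> K * (\<Sum>j<Suc n. weight j x)"
    by (simp add: chain_bound_def distrib_left)
  then have "ennreal (K * chain_bound n x) \<le> ennreal (K * (\<Sum>j<Suc n. weight j x))"
    by (rule ennreal_leI)
  also have "\<dots> = ennreal K * (\<Sum>j<Suc n. ennreal (weight j x))"
    using K weight_nonneg by (simp add: absorbing_def ennreal_mult sum_nonneg del: sum.lessThan_Suc)
  also have "\<dots> \<le> ennreal K * (\<Sum>j. ennreal (weight j x))"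
    by (intro mult_left_mono sum_le_suminf) auto
  also have "(\<Sum>j. ennreal (weight j x)) = B_const R * ((\<Sum>j. ennreal (weight j x)) / B_const R)"
    by (rule B_const_mult_divide[symmetric])
  also have "ennreal K * \<dots> \<le> ennreal K * (B_const R * sigma_fun \<phi> m x)"
    by (intro mult_left_mono suminf_weight_le_sigma) auto
  finally show ?thesis .
qed

lemma ex_local_mean_close:
  assumes f: "continuous_on UNIV f" "bounded (range f)" and "0 < e"
  shows "\<exists>n. ennreal \<bar>local_mean n f x - f x\<bar> \<le> ennreal e"
proof -
  obtain d where d: "0 < d" "\<And>v. dist v x < d \<Longrightarrow> dist (f v) (f x) < e"
    using f(1) \<open>0 < e\<close> unfolding continuous_on_iff by (metis UNIV_I)
  obtain n where n: "radius n x \<le> d / 2" using ex_radius_le[of "d / 2" x] d(1) by auto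
  have "ennreal \<bar>local_mean n f x - f x\<bar> \<le> (\<integral>\<^sup>+v. ennreal \<bar>f v - f x\<bar> \<partial>local_unif n x)"
    by (rule abs_local_mean_diff_le[OF f])
  also have "\<dots> \<le> (\<integral>\<^sup>+v. ennreal e \<partial>local_unif n x)"
  proof (intro nn_integral_mono_AE AE_local_unif ennreal_leI)
    fix v assume "dist x v \<le> radius n x"
    then have "dist v x < d" using d(1) n by (simp add: dist_commute)
    then show "\<bar>f v - f x\<bar> \<le> e" using d(2)[of v] by (simp add: dist_real_def)
  qed
  also have "\<dots> = ennreal e"
    using prob_space.emeasure_space_1[OF prob_space_local_unif[of x n]] by simp
  finally show ?thesis ..
qed

lemma abs_diff_expectation_le:
  assumes f: "continuous_on UNIV f" "bounded (range f)" and K: "absorbing K"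
  shows "ennreal \<bar>f x - expectation f\<bar>
    \<le> ennreal K * (B_const R * S_sup \<phi> m) + ennreal b * (\<Sum>j. energy j f)"
proof (rule ennreal_le_epsilon)
  fix e :: real assume "0 < e"
  then obtain n where n: "ennreal \<bar>local_mean n f x - f x\<bar> \<le> ennreal e"
    using ex_local_mean_close[OF f] by blast
  have "ennreal \<bar>local_mean n f x - expectation f\<bar>
      \<le> ennreal (K * chain_bound n x) + ennreal b * (\<Sum>j<n. energy j f)"
    by (rule abs_local_mean_diff_expectation_le[OF f K])
  also have "\<dots> \<le> ennreal K * (B_const R * S_sup \<phi> m) + ennreal b * (\<Sum>j. energy j f)"
    unfolding S_sup_def
    by (intro add_mono order_trans[OF chain_bound_le_sigma[OF K]] mult_left_mono SUP_upper
        sum_le_suminf) auto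
  finally have mean_bound: "ennreal \<bar>local_mean n f x - expectation f\<bar> \<le> \<dots>" .
  have "ennreal \<bar>f x - expectation f\<bar>
      \<le> ennreal (\<bar>local_mean n f x - expectation f\<bar> + \<bar>local_mean n f x - f x\<bar>)"
    by (intro ennreal_leI) simp
  also have "\<dots> = ennreal \<bar>local_mean n f x - expectation f\<bar> + ennreal \<bar>local_mean n f x - f x\<bar>"
    by simp
  also have "\<dots> \<le> ennreal K * (B_const R * S_sup \<phi> m) + ennreal b * (\<Sum>j. energy j f) + ennreal e"
    by (intro add_mono mean_bound n)
  finally show "ennreal \<bar>f x - expectation f\<bar> \<le> \<dots>" .
qed

end

section \<open>The measure on the product\<close>

lemma (in prob_space) ex_prob_space_dominating_density:
  fixes k :: "'a \<Rightarrow> ennreal"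
  assumes [measurable]: "k \<in> borel_measurable M" and C: "(\<integral>\<^sup>+x. k x \<partial>M) \<le> C" "C < \<infinity>"
  shows "\<exists>\<nu>. prob_space \<nu> \<and> sets \<nu> = sets M \<and>
    (\<forall>g\<in>borel_measurable M. (\<integral>\<^sup>+x. k x * g x \<partial>M) \<le> C * (\<integral>\<^sup>+x. g x \<partial>\<nu>))"
proof (cases "(\<integral>\<^sup>+x. k x \<partial>M) = 0")
  case True
  then have "AE x in M. k x = 0"
    by (simp add: nn_integral_0_iff_AE)
  then have "(\<integral>\<^sup>+x. k x * g x \<partial>M) = (\<integral>\<^sup>+x. 0 \<partial>M)" for g
    by (intro nn_integral_cong_AE) auto
  then show ?thesis using prob_space_axioms by auto
next
  case False
  define I where "I = (\<integral>\<^sup>+x. k x \<partial>M)"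
  have I: "I \<noteq> 0" "I < \<infinity>" using False C by (auto simp: I_def)
  define \<nu> where "\<nu> = density M (\<lambda>x. k x / I)"
  have "emeasure \<nu> (space \<nu>) = 1"
    using I unfolding \<nu>_def
    by (simp add: emeasure_density nn_integral_divide I_def[symmetric] ennreal_divide_self
        cong: nn_integral_cong_simp)
  moreover have "(\<integral>\<^sup>+x. k x * g x \<partial>M) \<le> C * (\<integral>\<^sup>+x. g x \<partial>\<nu>)"
    if [measurable]: "g \<in> borel_measurable M" for g
  proof -
    have "(\<integral>\<^sup>+x. g x \<partial>\<nu>) = (\<integral>\<^sup>+x. (k x * g x) / I \<partial>M)"
      unfolding \<nu>_def by (simp add: nn_integral_density divide_ennreal_def ac_simps)
    also have "\<dots> = (\<integral>\<^sup>+x. k x * g x \<partial>M) / I"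
      by (rule nn_integral_divide) measurable
    finally have "I * (\<integral>\<^sup>+x. g x \<partial>\<nu>) = (\<integral>\<^sup>+x. k x * g x \<partial>M)"
      using I by (simp add: ennreal_times_divide mult_divide_eq_ennreal mult.commute[of I])
    then show ?thesis
      using mult_right_mono[OF C(1), of "\<integral>\<^sup>+x. g x \<partial>\<nu>"] by (simp add: I_def)
  qed
  ultimately show ?thesis
    by (intro exI[of _ \<nu>]) (auto simp: \<nu>_def intro: prob_spaceI)
qed

context bounded_chaining
begin

definition chain_kernel :: "'a \<times> 'a \<Rightarrow> ennreal" where
  "chain_kernel z = (\<Sum>k. ennreal (weight k (fst z)) * ball_kernel (radius k) z)"

lemma chain_kernel_measurable [measurable]: "chain_kernel \<in> borel_measurable (m \<Otimes>\<^sub>M m)"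
proof -
  note [measurable] = ball_kernel_measurable[OF continuous_radius]
  show ?thesis unfolding chain_kernel_def by measurable
qed

lemma nn_integral_chain_kernel:
  assumes [measurable]: "g \<in> borel_measurable (m \<Otimes>\<^sub>M m)"
  shows "(\<integral>\<^sup>+z. chain_kernel z * g z \<partial>(m \<Otimes>\<^sub>M m))
    = (\<Sum>k. \<integral>\<^sup>+u. ennreal (weight k u) * (\<integral>\<^sup>+v. g (u, v) \<partial>local_unif k u) \<partial>m)"
proof -
  note [measurable] = ball_kernel_measurable[OF continuous_radius]
  have each_level: "(\<integral>\<^sup>+z. ennreal (weight k (fst z)) * ball_kernel (radius k) z * g z \<partial>(m \<Otimes>\<^sub>M m))
      = (\<integral>\<^sup>+u. ennreal (weight k u) * (\<integral>\<^sup>+v. g (u, v) \<partial>local_unif k u) \<partial>m)" for k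
    by (rule nn_integral_weighted_ball_kernel[OF continuous_radius]) measurable
  have "(\<integral>\<^sup>+z. chain_kernel z * g z \<partial>(m \<Otimes>\<^sub>M m))
      = (\<integral>\<^sup>+z. (\<Sum>k. ennreal (weight k (fst z)) * ball_kernel (radius k) z * g z) \<partial>(m \<Otimes>\<^sub>M m))"
    by (simp add: chain_kernel_def)
  also have "\<dots> = (\<Sum>k. \<integral>\<^sup>+z. ennreal (weight k (fst z)) * ball_kernel (radius k) z * g z \<partial>(m \<Otimes>\<^sub>M m))"
    by (rule nn_integral_suminf) measurable
  finally show ?thesis unfolding each_level .
qed

lemma nn_integral_chain_kernel_phi_slope:
  assumes "continuous_on UNIV f"
  shows "(\<integral>\<^sup>+z. chain_kernel z * phi_slope f z \<partial>(m \<Otimes>\<^sub>M m)) = (\<Sum>k. energy k f)"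
  using assms
  by (simp add: nn_integral_chain_kernel phi_slope_measurable_pair energy_def local_energy_def)

lemma nn_integral_chain_kernel_le: "(\<integral>\<^sup>+z. chain_kernel z \<partial>(m \<Otimes>\<^sub>M m)) \<le> B_const R * S_bar \<phi> m"
proof -
  have "emeasure (local_unif k u) UNIV = 1" for k u
    using prob_space.emeasure_space_1[OF prob_space_local_unif[of u k]] by (simp add: space_eq_UNIV)
  then have "(\<integral>\<^sup>+z. chain_kernel z \<partial>(m \<Otimes>\<^sub>M m)) = (\<Sum>k. \<integral>\<^sup>+u. ennreal (weight k u) \<partial>m)"
    using nn_integral_chain_kernel[of "\<lambda>_. 1"] by (simp add: space_eq_UNIV)
  also have "\<dots> = (\<integral>\<^sup>+u. (\<Sum>k. ennreal (weight k u)) \<partial>m)"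
    by (rule nn_integral_suminf[symmetric]) measurable
  also have "\<dots> = B_const R * ((\<integral>\<^sup>+u. (\<Sum>k. ennreal (weight k u)) \<partial>m) / B_const R)"
    by (rule B_const_mult_divide[symmetric])
  also have "\<dots> = B_const R * (\<integral>\<^sup>+u. (\<Sum>k. ennreal (weight k u)) / B_const R \<partial>m)"
    by (simp add: nn_integral_divide)
  also have "\<dots> \<le> B_const R * S_bar \<phi> m"
    unfolding S_bar_def by (intro mult_left_mono nn_integral_mono suminf_weight_le_sigma) simp
  finally show ?thesis .
qed

definition energy_dominating :: "('a \<times> 'a) measure \<Rightarrow> bool" where
  "energy_dominating \<nu> \<longleftrightarrow> (\<forall>f. continuous_on UNIV f \<longrightarrow>
    (\<Sum>k. energy k f) \<le> B_const R * S_bar \<phi> m * (\<integral>\<^sup>+z. phi_slope f z \<partial>\<nu>))"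

lemma ex_energy_dominating_measure:
  assumes "S_bar \<phi> m < \<infinity>"
  shows "\<exists>\<nu>. prob_space \<nu> \<and> sets \<nu> = sets borel \<and> energy_dominating \<nu>"
proof -
  interpret P: pair_prob_space m m ..
  have "B_const R * S_bar \<phi> m < \<infinity>"
    using assms B_const_finite by (simp add: ennreal_mult_less_top)
  from P.ex_prob_space_dominating_density[OF chain_kernel_measurable nn_integral_chain_kernel_le this]
  obtain \<nu> where "prob_space \<nu>" "sets \<nu> = sets borel"
    and "\<And>g. g \<in> borel_measurable (m \<Otimes>\<^sub>M m) \<Longrightarrow>
      (\<integral>\<^sup>+z. chain_kernel z * g z \<partial>(m \<Otimes>\<^sub>M m)) \<le> B_const R * S_bar \<phi> m * (\<integral>\<^sup>+z. g z \<partial>\<nu>)"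
    unfolding sets_pair_eq_borel by blast
  moreover from this(3)[OF phi_slope_measurable_pair] have "energy_dominating \<nu>"
    by (simp add: energy_dominating_def nn_integral_chain_kernel_phi_slope)
  ultimately show ?thesis by blast
qed

end

section \<open>The oscillation of a continuous function\<close>

definition (in chaining) chaining_bound ::
    "real \<Rightarrow> ('a \<times> 'a) measure \<Rightarrow> ('a \<Rightarrow> real) \<Rightarrow> ennreal" where
  "chaining_bound K \<nu> f = 2 * (ennreal K * (B_const R * S_sup \<phi> m)) +
     2 * (ennreal b * (B_const R * S_bar \<phi> m * (\<integral>\<^sup>+z. phi_slope f z \<partial>\<nu>)))"

context bounded_chaining
begin

lemma abs_diff_le_chaining_bound_if_bounded:
  assumes f: "continuous_on UNIV f" "bounded (range f)" and K: "absorbing K"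
    and \<nu>: "energy_dominating \<nu>"
  shows "ennreal \<bar>f s - f t\<bar> \<le> chaining_bound K \<nu> f"
proof -
  let ?D = "ennreal K * (B_const R * S_sup \<phi> m) + ennreal b * (\<Sum>k. energy k f)"
  have "ennreal \<bar>f s - f t\<bar> \<le> ennreal (\<bar>f s - expectation f\<bar> + \<bar>f t - expectation f\<bar>)"
    by (intro ennreal_leI) simp
  also have "\<dots> = ennreal \<bar>f s - expectation f\<bar> + ennreal \<bar>f t - expectation f\<bar>" by simp
  also have "\<dots> \<le> ?D + ?D" by (intro add_mono abs_diff_expectation_le f K)
  also have "\<dots> = 2 * ?D" by (simp add: mult_2)
  also have "\<dots> \<le> chaining_bound K \<nu> f"
    using \<nu> f(1) unfolding chaining_bound_def distrib_left energy_dominating_def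
    by (intro add_left_mono mult_left_mono) simp_all
  finally show ?thesis .
qed

lemma abs_diff_le_chaining_bound:
  assumes f: "continuous_on UNIV f" and K: "absorbing K" and \<nu>: "energy_dominating \<nu>"
  shows "ennreal \<bar>f s - f t\<bar> \<le> chaining_bound K \<nu> f"
proof -
  \<comment> \<open>The means need a bounded function, so \<open>f\<close> is truncated at a level that keeps \<open>f s\<close> and \<open>f t\<close>.\<close>
  define C where "C = max \<bar>f s\<bar> \<bar>f t\<bar>"
  define g where "g x = max (- C) (min C (f x))" for x
  have g: "continuous_on UNIV g" unfolding g_def by (intro continuous_intros f)
  have "0 \<le> C" by (simp add: C_def)
  then have "\<bar>g x\<bar> \<le> C" for x by (simp add: g_def abs_le_iff)
  then have "bounded (range g)" unfolding bounded_iff by auto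
  have "g s = f s" "g t = f t" by (auto simp: g_def C_def)
  then have "ennreal \<bar>f s - f t\<bar> = ennreal \<bar>g s - g t\<bar>" by simp
  also have "\<dots> \<le> chaining_bound K \<nu> g"
    by (rule abs_diff_le_chaining_bound_if_bounded[OF g \<open>bounded (range g)\<close> K \<nu>])
  also have "\<dots> \<le> chaining_bound K \<nu> f"
    unfolding chaining_bound_def
    by (intro add_left_mono mult_left_mono nn_integral_mono phi_slope_mono) (auto simp: g_def)
  finally show ?thesis .
qed

end

lemma A_const_eq_B_const:
  assumes "2 < R"
  shows "A_const R = ennreal (R / (R - 2)) * B_const R"
  using assms
  by (simp add: A_const_def B_const_def power2_eq_square power3_eq_cube mult.commute
      flip: ennreal_mult)

lemma (in G_levels) absorbing_if_R_gt_2: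
  assumes "2 < R"
  shows "absorbing (a * R / (R - 2))"
proof -
  define K where "K = a * R / (R - 2)"
  have "a \<le> a * (R / (R - 1))"
    using assms a_nonneg mult_left_mono[of 1 "R / (R - 1)" a] by simp
  also have "\<dots> = K * ((R - 2) / (R - 1))"
    using assms by (simp add: K_def)
  also have "\<dots> = K - K / (R - 1)"
    using assms by (simp add: field_simps)
  finally have "a + K / (R - 1) \<le> K" by simp
  moreover have "0 \<le> K" using assms a_nonneg by (simp add: K_def)
  ultimately show ?thesis by (simp add: absorbing_def K_def)
qed

context chaining
begin

lemma abs_diff_le_chaining_bound_if_S_bar_infinite:
  assumes f: "continuous_on UNIV f" and "S_bar \<phi> m = \<infinity>"
  shows "ennreal \<bar>f s - f t\<bar> \<le> chaining_bound K (m \<Otimes>\<^sub>M m) f"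
proof (cases "(\<integral>\<^sup>+z. phi_slope f z \<partial>(m \<Otimes>\<^sub>M m)) = 0")
  case True
  then have "AE z in m \<Otimes>\<^sub>M m. phi_slope f z = 0"
    using phi_slope_measurable_pair[OF f] by (simp add: nn_integral_0_iff_AE)
  then have "AE (u, v) in m \<Otimes>\<^sub>M m. f u = f v"
    by (elim eventually_mono) (auto simp: phi_slope_eq_0_iff)
  then have "f s = f t" by (rule AE_pair_eq_imp_constant[OF f])
  then show ?thesis by simp
next
  case False
  then show ?thesis
    using assms(2) b_pos B_const_pos
    by (simp add: chaining_bound_def ennreal_mult_top ennreal_top_mult)
qed

lemma ex_chaining_measure:
  "\<exists>\<nu>. prob_space \<nu> \<and> sets \<nu> = sets borel \<and>
    (\<forall>f K s t. continuous_on UNIV f \<longrightarrow> absorbing K \<longrightarrow> ennreal \<bar>f s - f t\<bar> \<le> chaining_bound K \<nu> f)"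
proof (cases "S_bar \<phi> m < \<infinity>")
  case True
  interpret bounded_chaining m a b R \<phi>
    by unfold_locales (rule bounded_if_S_bar_finite[OF True])
  show ?thesis
    using ex_energy_dominating_measure[OF True] abs_diff_le_chaining_bound by blast
next
  case False
  interpret P: pair_prob_space m m ..
  show ?thesis
    using False P.prob_space_axioms sets_pair_eq_borel
    by (intro exI[of _ "m \<Otimes>\<^sub>M m"])
      (auto simp: not_less top_unique intro: abs_diff_le_chaining_bound_if_S_bar_infinite)
qed

lemma A_const_S_sup_infinite:
  assumes "0 < a" "R = 2" "(s :: 'a) \<noteq> t"
  shows "ennreal a * (A_const R * S_sup \<phi> m) = \<infinity>"
proof -
  have "0 < ennreal (inv_nonneg \<phi> 1 * dist s t)"
    using inv_nonneg_one_pos assms(3) by simp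
  then have "0 < S_sup \<phi> m" using S_sup_ge by (rule less_le_trans)
  then show ?thesis
    using assms by (simp add: A_const_def ennreal_mult_top ennreal_top_mult)
qed

lemma abs_diff_le_if_le_chaining_bound:
  assumes "2 \<le> R"
    and bound: "\<And>K. absorbing K \<Longrightarrow> ennreal \<bar>f s - f t\<bar> \<le> chaining_bound K \<nu> f"
  shows "ennreal \<bar>f s - f t\<bar> \<le> 2 * ennreal a * A_const R * S_sup \<phi> m +
    2 * ennreal b * B_const R * S_bar \<phi> m * (\<integral>\<^sup>+z. phi_slope f z \<partial>\<nu>)"
proof -
  consider (R_gt_2) "2 < R" | (a_zero) "a = 0" | (s_eq_t) "s = t"
    | (A_infinite) "R = 2" "0 < a" "s \<noteq> t"
    using \<open>2 \<le> R\<close> a_nonneg by argo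
  then show ?thesis
  proof cases
    case R_gt_2
    then show ?thesis
      using bound[OF absorbing_if_R_gt_2] a_nonneg
      by (simp add: chaining_bound_def A_const_eq_B_const ennreal_mult mult.assoc
          flip: times_divide_eq_right)
  next
    case a_zero
    then have "absorbing 0" unfolding absorbing_def by simp
    from bound[OF this] a_zero show ?thesis by (simp add: chaining_bound_def mult.assoc)
  next
    case s_eq_t
    then show ?thesis by simp
  next
    case A_infinite
    then show ?thesis
      using A_const_S_sup_infinite[of s t] by (simp add: mult.assoc ennreal_mult_top)
  qed
qed

end

theorem corollary1p1:
  fixes m :: "'a::metric_space measure"
    and a b R :: real
    and \<phi> :: "real \<Rightarrow> real"
  assumes "prob_space m"
    and "sets m = sets borel"
    and "measure_support m = UNIV"
    and "a \<ge> 0" and "b \<ge> 0"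
    and "\<phi> \<in> G_class a b"
    and "R \<ge> 2"
  shows "\<exists>\<nu> :: ('a \<times> 'a) measure. prob_space \<nu> \<and> sets \<nu> = sets borel \<and>
    (\<forall>f :: 'a \<Rightarrow> real. continuous_on UNIV f \<longrightarrow>
      (SUP s. SUP t. ennreal \<bar>f s - f t\<bar>) \<le>
        2 * ennreal a * A_const R * S_sup \<phi> m +
        2 * ennreal b * B_const R * S_bar \<phi> m *
          (\<integral>\<^sup>+(u, v). ennreal (\<phi> (\<bar>f u - f v\<bar> / dist u v)) \<partial>\<nu>))"
proof -
  interpret prob_space m by fact
  interpret chaining m a b R \<phi>
    using assms(2-) by unfold_locales auto
  obtain \<nu> where \<nu>: "prob_space \<nu>" "sets \<nu> = sets borel"
    and bound: "\<And>f K s t. continuous_on UNIV f \<Longrightarrow> absorbing K \<Longrightarrow> ennreal \<bar>f s - f t\<bar> \<le> chaining_bound K \<nu> f"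
    using ex_chaining_measure by blast
  show ?thesis
    unfolding phi_slope_def[symmetric]
    by (intro exI[of _ \<nu>] conjI allI impI SUP_least \<nu>
        abs_diff_le_if_le_chaining_bound[OF \<open>R \<ge> 2\<close>] bound)
qed

end
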